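(* Let $\mathbf{H}=\mathbf{H}^\top\in\mathbb{R}^{s\times s}$ be positive definite, $\mathbf{G}\in\mathbb{R}^{m\times s}$, $\mathbf{W}\in\mathbb{R}^m$, $\mathbf{S}\in\mathbb{R}^{m\times n}$, and consider the multi-parametric quadratic program $$V(\mathbf{x})=\min_{\mathbf{z}\in\mathbb{R}^s}\left\{\tfrac12\mathbf{z}^\top\mathbf{H}\mathbf{z} : \mathbf{G}\mathbf{z}\le\mathbf{W}+\mathbf{S}\mathbf{x}\right\},$$ where the set of feasible parameters $\mathcal{X}=\{\mathbf{x}\in\mathbb{R}^n : \exists\,\mathbf{z}\in\mathbb{R}^s,\ \mathbf{G}\mathbf{z}\le\mathbf{W}+\mathbf{S}\mathbf{x}\}$ is full-dimensional. Suppose that the Linear Independence Constraint Qualification (LICQ) holds for all $\mathbf{x}\in\mathcal{X}$. Then the value function $V$ is continuously differentiable on $\mathrm{int}(\mathcal{X})$, and $$\nabla_{\mathbf{x}}V(\mathbf{x})=-\mathbf{S}^\top\boldsymbol{\lambda}^*(\mathbf{x})\qquad\text{for all }\mathbf{x}\in\mathrm{int}(\mathcal{X}),$$ where $\boldsymbol{\lambda}^*(\mathbf{x})$ is an optimizer of the dual problem $$V_{\mathrm{D}}(\mathbf{x})=\max_{\boldsymbol{\lambda}\in\mathbb{R}^m}\left\{-\tfrac12\boldsymbol{\lambda}^\top\mathbf{G}\mathbf{H}^{-1}\mathbf{G}^\top\boldsymbol{\lambda}-\boldsymbol{\lambda}^\top(\mathbf{W}+\mathbf{S}\mathbf{x})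 : \boldsymbol{\lambda}\ge\mathbf{0}_m\right\}.$$
   Context: Vector inequalities are componentwise. A subset of $\mathbb{R}^n$ is full-dimensional if it has nonempty interior. For $\mathbf{x}\in\mathcal{X}$, $\mathbf{z}^*(\mathbf{x})$ denotes the (unique) minimizer of the quadratic program at $\mathbf{x}$, and the active set is $\mathcal{A}(\mathbf{x})=\{i\in\{1,\dots,m\} : \mathbf{G}_i\mathbf{z}^*(\mathbf{x})=W_i+\mathbf{S}_i\mathbf{x}\}$, where $\mathbf{G}_i,\mathbf{S}_i$ denote the $i$-th rows. LICQ holds at $\mathbf{x}$ if the rows $\mathbf{G}_i$, $i\in\mathcal{A}(\mathbf{x})$, are linearly independent (vacuously true if $\mathcal{A}(\mathbf{x})=\emptyset$). The gradient $\nabla_{\mathbf{x}}V$ is a column vector in $\mathbb{R}^n$. *)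

theory Defs
  imports "HOL-Analysis.Analysis"
begin

definition symmetric_matrix :: "real^'s^'s \<Rightarrow> bool" where
  "symmetric_matrix H \<longleftrightarrow> transpose H = H"

definition positive_definite :: "real^'s^'s \<Rightarrow> bool" where
  "positive_definite H \<longleftrightarrow> (\<forall>z. z \<noteq> 0 \<longrightarrow> z \<bullet> (H *v z) > 0)"

definition full_dimensional :: "'a::topological_space set \<Rightarrow> bool" where
  "full_dimensional X \<longleftrightarrow> interior X \<noteq> {}"

definition primal_objective :: "real^'s^'s \<Rightarrow> real^'s \<Rightarrow> real" where
  "primal_objective H z = 1/2 * (z \<bullet> (H *v z))"

(* The order on real^'m is componentwise. *)
definition primal_feasible ::
  "real^'s^'m \<Rightarrow> real^'m \<Rightarrow> real^'n^'m \<Rightarrow> real^'n \<Rightarrow> real^'s \<Rightarrow> bool" where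
  "primal_feasible G W S x z \<longleftrightarrow> G *v z \<le> W + S *v x"

definition feasible_parameters ::
  "real^'s^'m \<Rightarrow> real^'m \<Rightarrow> real^'n^'m \<Rightarrow> (real^'n) set" where
  "feasible_parameters G W S = {x. \<exists>z. primal_feasible G W S x z}"

(* For positive definite H and feasible x the minimizer exists and is unique,
   so the choice made by arg_min is immaterial there. For infeasible x this
   and primal_value below are unspecified. *)
definition primal_minimizer ::
  "real^'s^'s \<Rightarrow> real^'s^'m \<Rightarrow> real^'m \<Rightarrow> real^'n^'m \<Rightarrow> real^'n \<Rightarrow> real^'s" where
  "primal_minimizer H G W S x = arg_min (primal_objective H) (primal_feasible G W S x)"

definition primal_value ::
  "real^'s^'s \<Rightarrow> real^'s^'m \<Rightarrow> real^'m \<Rightarrow> real^'n^'m \<Rightarrow> real^'n \<Rightarrow> real" where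
  "primal_value H G W S x = primal_objective H (primal_minimizer H G W S x)"

definition active_set ::
  "real^'s^'s \<Rightarrow> real^'s^'m \<Rightarrow> real^'m \<Rightarrow> real^'n^'m \<Rightarrow> real^'n \<Rightarrow> 'm set" where
  "active_set H G W S x =
     {i. row i G \<bullet> primal_minimizer H G W S x = W $ i + row i S \<bullet> x}"

(* Linear independence of the rows as an indexed family: injectivity rules out
   equal rows at two different active indices. *)
definition LICQ ::
  "real^'s^'s \<Rightarrow> real^'s^'m \<Rightarrow> real^'m \<Rightarrow> real^'n^'m \<Rightarrow> real^'n \<Rightarrow> bool" where
  "LICQ H G W S x \<longleftrightarrow>
     inj_on (\<lambda>i. row i G) (active_set H G W S x) \<and>
     independent ((\<lambda>i. row i G) ` active_set H G W S x)"

definition dual_objective ::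
  "real^'s^'s \<Rightarrow> real^'s^'m \<Rightarrow> real^'m \<Rightarrow> real^'n^'m \<Rightarrow> real^'n \<Rightarrow> real^'m \<Rightarrow> real" where
  "dual_objective H G W S x l =
     - (1/2) * (l \<bullet> ((G ** matrix_inv H ** transpose G) *v l)) - l \<bullet> (W + S *v x)"

definition dual_optimizer ::
  "real^'s^'s \<Rightarrow> real^'s^'m \<Rightarrow> real^'m \<Rightarrow> real^'n^'m \<Rightarrow> real^'n \<Rightarrow> real^'m \<Rightarrow> bool" where
  "dual_optimizer H G W S x l \<longleftrightarrow> is_arg_max (dual_objective H G W S x) (\<lambda>l. l \<ge> 0) l"

(* Intended for open U; the derivative is the full Frechet derivative,
   represented by its gradient. *)
definition continuously_differentiable_on ::
  "('a::real_inner \<Rightarrow> real) \<Rightarrow> 'a set \<Rightarrow> bool" where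
  "continuously_differentiable_on f U \<longleftrightarrow>
     (\<exists>g. (\<forall>x\<in>U. GDERIV f x :> g x) \<and> continuous_on U g)"

end

theory Submission
  imports Defs
begin

text \<open>
  If \<open>l\<close> solves the dual at \<open>x\<close>, then \<open>l\<close> is dual feasible at every other parameter, so weak duality
  there and strong duality at \<open>x\<close> make \<open>- transpose S *v l\<close> a subgradient of the value function.
  LICQ gives a linear right inverse \<open>L\<close> of the active rows of \<open>G\<close>. Moving the minimizer by
  \<open>L (S *v (y - x))\<close> keeps it feasible for \<open>y\<close> near \<open>x\<close> and bounds the value function from above by
  the affine minorant plus a quadratic term, so it is differentiable at \<open>x\<close>; the same \<open>L\<close>
  produces the multipliers without Farkas' lemma. Finally, a differentiable function whose
  gradients are global subgradients has a continuous gradient.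
\<close>

subsection \<open>Subgradients and gradients\<close>

text \<open>The first-order remainder is caught between 0 and a quadratic term, so its quotient by
  \<open>norm (y - x)\<close> tends to 0.\<close>

lemma GDERIV_sandwich:
  fixes f :: "'a::real_inner \<Rightarrow> real"
  assumes lower: "eventually (\<lambda>y. f x + p \<bullet> (y - x) \<le> f y) (nhds x)"
    and upper: "eventually (\<lambda>y. f y \<le> f x + p \<bullet> (y - x) + C * (norm (y - x))\<^sup>2) (nhds x)"
  shows "GDERIV f x :> p"
  unfolding gderiv_def has_derivative_iff_norm
proof
  show "bounded_linear (\<lambda>h. h \<bullet> p)"
    by (rule bounded_linear_inner_left)
  have "eventually (\<lambda>y. f x + p \<bullet> (y - x) \<le> f y \<and> f y \<le> f x + p \<bullet> (y - x) + C * (norm (y - x))\<^sup>2)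
      (at x)"
    using lower upper by (auto simp: eventually_at_filter elim: eventually_elim2)
  then have "eventually (\<lambda>y. norm (norm (f y - f x - (y - x) \<bullet> p) / norm (y - x)) \<le> C * norm (y - x)) (at x)"
    using eventually_neq_at_within[of x x UNIV]
  proof eventually_elim
    case (elim y)
    then have "\<bar>f y - f x - (y - x) \<bullet> p\<bar> \<le> C * norm (y - x) * norm (y - x)"
      by (auto simp: inner_commute power2_eq_square algebra_simps)
    then show ?case
      using elim by (simp add: divide_le_eq)
  qed
  moreover have "((\<lambda>y. C * norm (y - x)) \<longlongrightarrow> 0) (at x)"
    by (auto intro!: tendsto_eq_intros)
  ultimately show "((\<lambda>y. norm (f y - f x - (y - x) \<bullet> p) / norm (y - x)) \<longlongrightarrow> 0) (at x)"
    by (rule Lim_null_comparison)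
qed

text \<open>Subtracting the linear functional given by \<open>p\<close> from \<open>f\<close> leaves
  a local minimum at \<open>x\<close>, where the derivative must vanish. This carries the gradient
  formula from one dual optimizer to all of them.\<close>

lemma GDERIV_subgradient_unique:
  fixes f :: "'a::real_inner \<Rightarrow> real"
  assumes deriv: "GDERIV f x :> g"
    and sub: "eventually (\<lambda>y. f x + p \<bullet> (y - x) \<le> f y) (nhds x)"
  shows "p = g"
proof -
  define F where "F y = f y - y \<bullet> p" for y
  have "FDERIV F x :> (\<lambda>h. h \<bullet> g - h \<bullet> p)"
    using deriv unfolding gderiv_def F_def
    by (intro has_derivative_diff bounded_linear.has_derivative[OF bounded_linear_inner_left]) auto
  moreover have "eventually (\<lambda>y. F x \<le> F y) (at x)"
    using sub by (auto simp: F_def eventually_at_filter inner_commute algebra_simps elim: eventually_mono)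
  ultimately have "(\<lambda>h. h \<bullet> g - h \<bullet> p) = (\<lambda>h. 0)"
    by (rule has_derivative_local_min)
  \<comment> \<open>Evaluating at the direction \<open>g - p\<close> leaves its squared
    norm.\<close>
  then have "(g - p) \<bullet> g - (g - p) \<bullet> p = 0"
    by meson
  then show ?thesis
    by (simp flip: inner_diff_right)
qed

text \<open>Chaining the subgradient inequalities from \<open>x\<close> to \<open>y\<close> and from
  \<open>y\<close> to \<open>w\<close> bounds \<open>(g y - g x) \<bullet> (w - y)\<close> by the
  first-order remainder of \<open>f\<close> at \<open>x\<close>, evaluated at \<open>w\<close>;
  differentiability makes that remainder small.\<close>

lemma continuous_on_subgradient:
  fixes f :: "'a::real_inner \<Rightarrow> real"
  assumes U: "open U"
    and sub: "\<And>x y. x \<in> U \<Longrightarrow> y \<in> U \<Longrightarrow> f x + g x \<bullet> (y - x) \<le> f y"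
    and deriv: "\<And>x. x \<in> U \<Longrightarrow> GDERIV f x :> g x"
  shows "continuous_on U g"
  unfolding continuous_on_iff
proof (intro ballI allI impI)
  fix x and e :: real
  assume x: "x \<in> U" and e: "0 < e"
  from U x obtain r0 where r0: "r0 > 0" "ball x r0 \<subseteq> U"
    by (meson open_contains_ball)
  have "\<exists>d>0. \<forall>y. norm (y - x) < d \<longrightarrow> norm (f y - f x - (y - x) \<bullet> g x) \<le> e/4 * norm (y - x)"
    using deriv[OF x] e unfolding gderiv_def has_derivative_at_alt by (meson divide_pos_pos zero_less_numeral)
  then obtain d where d: "d > 0"
    "\<And>y. norm (y - x) < d \<Longrightarrow> norm (f y - f x - (y - x) \<bullet> g x) \<le> e/4 * norm (y - x)"
    by blast
  \<comment> \<open>Halving makes \<open>r\<close> strictly smaller than \<open>d\<close> and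
    \<open>r0\<close>. The steps from \<open>x\<close> to \<open>y\<close> and from \<open>y\<close>
    to \<open>w\<close> each use up \<open>r/2\<close>, and the tolerance \<open>e/4\<close> then
    yields \<open>e/2\<close>.\<close>
  define r where "r = min d r0 / 2"
  have r: "r > 0" "r < d" "r < r0"
    using d r0 by (auto simp: r_def min_def)
  show "\<exists>d>0. \<forall>y\<in>U. dist y x < d \<longrightarrow> dist (g y) (g x) < e"
  proof (intro exI[of _ "r/2"] conjI ballI impI)
    show "r/2 > 0" using r by simp
    fix y assume y: "y \<in> U" "dist y x < r/2"
    \<comment> \<open>compare \<open>f\<close> at the point reached from \<open>y\<close> in the direction of the gradient increment\<close>
    define w where "w = y + (r/2) *\<^sub>R sgn (g y - g x)"
    have "norm (w - y) \<le> r/2"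
      using r by (simp add: w_def norm_sgn)
    then have nw: "norm (w - x) \<le> r"
      using y norm_triangle_ineq[of "w - y" "y - x"] by (simp add: dist_norm)
    then have w: "w \<in> U" using r r0 by (auto simp: dist_norm norm_minus_commute subset_iff)
    have "f w - f x - (w - x) \<bullet> g x \<le> e/4 * norm (w - x)"
      using order_trans[OF abs_ge_self d(2)[of w, unfolded real_norm_def]] nw r by simp
    also have "\<dots> \<le> e/4 * r" using nw e by (intro mult_left_mono) auto
    finally have "f w - f x - (w - x) \<bullet> g x \<le> e/4 * r" .
    moreover have "f y + g y \<bullet> (w - y) \<le> f w" "f x + g x \<bullet> (y - x) \<le> f y"
      using sub w x y by auto
    ultimately have "(g y - g x) \<bullet> (w - y) \<le> e/4 * r"
      by (simp add: inner_commute algebra_simps)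
    moreover have "(g y - g x) \<bullet> sgn (g y - g x) = norm (g y - g x)"
      by (cases "g y = g x")
        (simp_all add: sgn_div_norm dot_square_norm power2_eq_square)
    ultimately have "norm (g y - g x) * (r/2) \<le> e/4 * r"
      by (simp add: w_def mult.commute)
    then have "norm (g y - g x) \<le> e/2" using r by (simp add: field_simps)
    then show "dist (g y) (g x) < e" using e by (simp add: dist_norm)
  qed
qed

subsection \<open>Linear algebra\<close>

lemma row_inner: "row i A \<bullet> v = (A *v v) $ i" for A :: "real^'n^'m"
  by (simp add: row_def matrix_vector_mul_component)

lemma transpose_inner: "(transpose A *v l) \<bullet> v = l \<bullet> (A *v v)" for A :: "real^'n^'m"
  by (simp add: dot_lmul_matrix)

text \<open>Independence gives a linear \<open>g\<close> sending \<open>row i G\<close> to the i-th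
  axis vector, and injectivity lets \<open>inv_into\<close> recover the index. Its adjoint serves as
  \<open>L\<close>, since
  \<open>row i G \<bullet> adjoint g w = g (row i G) \<bullet> w\<close>.\<close>

lemma exists_right_inverse_on_rows:
  fixes G :: "real^'s^'m"
  assumes "inj_on (\<lambda>i. row i G) A" and "independent ((\<lambda>i. row i G) ` A)"
  obtains L :: "real^'m \<Rightarrow> real^'s" where "linear L" and "\<And>i w. i \<in> A \<Longrightarrow> (G *v L w) $ i = w $ i"
proof -
  obtain g :: "real^'s \<Rightarrow> real^'m" where g: "linear g"
    "\<forall>v\<in>(\<lambda>i. row i G) ` A. g v = axis (inv_into A (\<lambda>i. row i G) v) 1"
    using linear_independent_extend[OF assms(2), of "\<lambda>v. axis (inv_into A (\<lambda>i. row i G) v) 1"]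
    by metis
  have "(G *v adjoint g w) $ i = w $ i" if "i \<in> A" for i w
  proof -
    have "(G *v adjoint g w) $ i = g (row i G) \<bullet> w"
      by (simp only: row_inner[symmetric] adjoint_works[OF g(1)])
    also have "g (row i G) = axis i 1" using g(2) that inv_into_f_f[OF assms(1) that] by simp
    finally show ?thesis by (simp add: inner_axis')
  qed
  then show ?thesis using that adjoint_linear[OF g(1)] by blast
qed

lemma quadratic_form_linear_bound:
  fixes Q :: "real^'s^'s" and M :: "'a::euclidean_space \<Rightarrow> real^'s"
  assumes "linear M"
  obtains C where "\<And>h. M h \<bullet> (Q *v M h) \<le> C * (norm h)\<^sup>2"
proof -
  have "bounded_linear M" "bounded_linear (\<lambda>h. Q *v M h)"
    using assms by (auto intro: linear_conv_bounded_linear[THEN iffD1] linear_compose[unfolded o_def])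
  then obtain a b where a: "\<And>h. norm (M h) \<le> norm h * a" "a \<ge> 0" and b: "\<And>h. norm (Q *v M h) \<le> norm h * b"
    by (metis bounded_linear.nonneg_bounded)
  have "M h \<bullet> (Q *v M h) \<le> a * b * (norm h)\<^sup>2" for h
  proof -
    have "M h \<bullet> (Q *v M h) \<le> norm (M h) * norm (Q *v M h)" by (rule norm_cauchy_schwarz)
    also have "\<dots> \<le> (norm h * a) * (norm h * b)"
      using a b by (intro mult_mono) auto
    finally show ?thesis by (simp add: power2_eq_square mult_ac)
  qed
  then show ?thesis using that by blast
qed

subsection \<open>The quadratic program\<close>

locale mpqp =
  fixes H :: "real^'s^'s" and G :: "real^'s^'m" and W :: "real^'m" and S :: "real^'n^'m"
  assumes sym: "symmetric_matrix H" and pd: "positive_definite H"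
begin

abbreviation "X \<equiv> feasible_parameters G W S"
abbreviation "V \<equiv> primal_value H G W S"
abbreviation "zmin \<equiv> primal_minimizer H G W S"
abbreviation "feas \<equiv> primal_feasible G W S"
abbreviation "obj \<equiv> primal_objective H"
abbreviation "act \<equiv> active_set H G W S"
abbreviation "dual \<equiv> dual_objective H G W S"

lemma feas_iff: "feas x z \<longleftrightarrow> (\<forall>i. (G *v z) $ i \<le> W $ i + (S *v x) $ i)"
  by (simp add: primal_feasible_def less_eq_vec_def)

lemma H_inner_commute: "u \<bullet> (H *v v) = v \<bullet> (H *v u)"
proof -
  have "u \<bullet> (H *v v) = (transpose H *v u) \<bullet> v" by (simp only: transpose_inner)
  also have "\<dots> = v \<bullet> (H *v u)" using sym by (simp add: symmetric_matrix_def inner_commute)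
  finally show ?thesis .
qed

lemma H_nonneg: "z \<bullet> (H *v z) \<ge> 0"
  using pd by (cases "z = 0") (auto simp: positive_definite_def intro: less_imp_le)

lemma obj_add: "obj (z + d) = obj z + d \<bullet> (H *v z) + obj d"
  using H_inner_commute[of z d]
  unfolding primal_objective_def matrix_vector_right_distrib inner_add_left inner_add_right
  by argo

lemma obj_scaleR: "obj (t *\<^sub>R z) = t\<^sup>2 * obj z"
  unfolding primal_objective_def matrix_vector_mult_scaleR inner_scaleR_left inner_scaleR_right power2_eq_square
  by simp

lemma H_matrix_inv: "H *v (matrix_inv H *v y) = y"
  and matrix_inv_H: "matrix_inv H *v (H *v y) = y"
proof -
  have "inj ((*v) H)"
  proof (rule injI)
    fix u v assume "H *v u = H *v v"
    then have "(u - v) \<bullet> (H *v (u - v)) = 0" by (simp add: matrix_vector_mult_diff_distrib)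
    then show "u = v" using pd unfolding positive_definite_def
      by (metis less_irrefl right_minus_eq)
  qed
  then have "\<exists>B. H ** B = mat 1 \<and> B ** H = mat 1"
    by (metis matrix_left_invertible_injective matrix_left_right_inverse)
  \<comment> \<open>\<open>matrix_inv\<close> is a choice term, so its laws rest on the existence of
    a two-sided inverse.\<close>
  then have "H ** matrix_inv H = mat 1 \<and> matrix_inv H ** H = mat 1"
    unfolding matrix_inv_def by (rule someI2_ex) blast
  then show "H *v (matrix_inv H *v y) = y" "matrix_inv H *v (H *v y) = y"
    by (simp_all add: matrix_vector_mul_assoc)
qed

text \<open>The constant is the minimum over the compact unit sphere, positive by definiteness;
  homogeneity of degree 2 extends the bound to all \<open>z\<close>.\<close>

lemma obj_coercive: obtains c where "c > 0" "\<And>z. c * (norm z)\<^sup>2 \<le> obj z"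
proof -
  have "continuous_on (sphere 0 1) obj"
    unfolding primal_objective_def by (intro continuous_intros)
  then obtain u where u: "u \<in> sphere 0 1" "\<And>v. v \<in> sphere 0 1 \<Longrightarrow> obj u \<le> obj v"
    using continuous_attains_inf[of "sphere 0 1" obj] by auto
  have "u \<noteq> 0" using u(1) by auto
  then have "obj u > 0"
    using pd by (simp add: primal_objective_def positive_definite_def)
  moreover have "obj u * (norm z)\<^sup>2 \<le> obj z" for z
  proof (cases "z = 0")
    case False
    then have "obj u \<le> obj (z /\<^sub>R norm z)" by (intro u(2)) simp
    also have "\<dots> = obj z / (norm z)\<^sup>2"
      by (simp add: obj_scaleR divide_inverse mult.commute flip: power_inverse)
    finally show ?thesis using False by (simp add: field_simps)
  qed (simp add: primal_objective_def)
  ultimately show ?thesis using that by blast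
qed

lemma zmin_is_arg_min:
  assumes "x \<in> X" shows "is_arg_min obj (feas x) (zmin x)"
proof -
  obtain z0 where z0: "feas x z0" using assms by (auto simp: feasible_parameters_def)
  obtain c where c: "c > 0" "\<And>z. c * (norm z)\<^sup>2 \<le> obj z" using obj_coercive by blast
  \<comment> \<open>By coercivity \<open>R\<close> bounds every point no worse than
    \<open>z0\<close>, so the minimum over the compact set \<open>?K\<close> is global.\<close>
  define R where "R = sqrt (obj z0 / c)"
  have large: "norm z \<le> R" if "obj z \<le> obj z0" for z
    unfolding R_def using c that by (intro real_le_rsqrt) (simp add: field_simps, meson order_trans)
  let ?K = "{z. feas x z} \<inter> cball 0 R"
  have "closed {z. feas x z}"
    unfolding feas_iff by (intro closed_Collect_all closed_Collect_le continuous_intros)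
  then have "compact ?K" by (simp add: closed_Int_compact)
  moreover have "z0 \<in> ?K" using z0 large by simp
  moreover have "continuous_on ?K obj" unfolding primal_objective_def by (intro continuous_intros)
  ultimately obtain z where z: "z \<in> ?K" "\<And>y. y \<in> ?K \<Longrightarrow> obj z \<le> obj y"
    using continuous_attains_inf[of ?K obj] by blast
  have "obj z \<le> obj y" if "feas x y" for y
    using z(2)[of y] z(2)[OF \<open>z0 \<in> ?K\<close>] large[of y] that by (cases "obj y \<le> obj z0") auto
  then have "is_arg_min obj (feas x) z" using z(1) by (auto simp: is_arg_min_linorder)
  then show ?thesis unfolding primal_minimizer_def arg_min_def by (rule someI)
qed

lemma zmin_feas: "x \<in> X \<Longrightarrow> feas x (zmin x)"
  and V_le: "x \<in> X \<Longrightarrow> feas x z \<Longrightarrow> V x \<le> obj z"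
  using zmin_is_arg_min by (auto simp: is_arg_min_linorder primal_value_def)

lemma feas_imp_X: "feas x z \<Longrightarrow> x \<in> X"
  by (auto simp: feasible_parameters_def)

subsection \<open>Duality\<close>

lemma dual_quadratic:
  "l \<bullet> ((G ** matrix_inv H ** transpose G) *v l)
    = (transpose G *v l) \<bullet> (matrix_inv H *v (transpose G *v l))"
  by (simp add: transpose_inner matrix_vector_mul_assoc matrix_mul_assoc del: transpose_matrix_vector)

text \<open>With \<open>v\<close> the image of \<open>transpose G *v l\<close> under the inverse of
  \<open>H\<close>, the duality gap is at least \<open>obj (z + v)\<close>, which is
  nonnegative.\<close>

lemma weak_duality:
  assumes "feas x z" and "l \<ge> 0" shows "dual x l \<le> obj z"
proof -
  define v where "v = matrix_inv H *v (transpose G *v l)"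
  have Hv: "transpose G *v l = H *v v" by (simp add: v_def H_matrix_inv del: transpose_matrix_vector)
  have "l \<bullet> (G *v z) \<le> l \<bullet> (W + S *v x)"
    using assms unfolding inner_vec_def feas_iff
    by (intro sum_mono) (auto simp: less_eq_vec_def intro: mult_left_mono)
  moreover have "l \<bullet> (G *v z) = z \<bullet> (H *v v)"
    by (metis transpose_inner Hv inner_commute)
  moreover have "l \<bullet> ((G ** matrix_inv H ** transpose G) *v l) = v \<bullet> (H *v v)"
    unfolding dual_quadratic Hv by (metis Hv inner_commute v_def)
  moreover have "0 \<le> obj (z + v)" using H_nonneg by (simp add: primal_objective_def)
  ultimately show ?thesis
    unfolding dual_objective_def obj_add using H_inner_commute[of z v] by (simp add: primal_objective_def)
qed

text \<open>The parameter enters the dual objective only through a linear term, whose slope is the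
  claimed gradient.\<close>

lemma dual_affine: "dual y l = dual x l - (transpose S *v l) \<bullet> (y - x)"
  by (simp only: dual_objective_def transpose_inner)
    (simp add: inner_add_right matrix_vector_mult_diff_distrib inner_diff_right)

lemma subgradient:
  assumes "l \<ge> 0" and "dual x l = V x" and "y \<in> X"
  shows "V x + (- (transpose S *v l)) \<bullet> (y - x) \<le> V y"
  using weak_duality[OF zmin_feas[OF assms(3)] assms(1)] dual_affine[of y l x] assms(2)
  by (simp add: primal_value_def)

text \<open>Weak duality bounds the dual objective by \<open>V x\<close>, and \<open>l0\<close>
  attains this bound, so the dual maximum is \<open>V x\<close>.\<close>

lemma dual_optimizer_iff:
  assumes "x \<in> X" and "l0 \<ge> 0" and "dual x l0 = V x"
  shows "dual_optimizer H G W S x l \<longleftrightarrow> l \<ge> 0 \<and> dual x l = V x"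
  using weak_duality[OF zmin_feas[OF assms(1)]] assms
  by (fastforce simp: dual_optimizer_def is_arg_max_def primal_value_def not_less)

subsection \<open>Consequences of LICQ\<close>

lemma mem_act: "i \<in> act x \<longleftrightarrow> (G *v zmin x) $ i = W $ i + (S *v x) $ i"
  by (simp add: active_set_def row_inner)

text \<open>Inactive constraints are strict at the minimizer and survive small perturbations. The
  filter is left general to cover both one-sided motion along a ray and a varying parameter.\<close>

lemma eventually_feas:
  assumes x: "x \<in> X" and y: "(y \<longlongrightarrow> x) F" and z: "(z \<longlongrightarrow> zmin x) F"
    and act: "\<And>i. i \<in> act x \<Longrightarrow> eventually (\<lambda>t. (G *v z t) $ i \<le> W $ i + (S *v y t) $ i) F"
  shows "eventually (\<lambda>t. feas (y t) (z t)) F"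
  unfolding feas_iff
proof (rule eventually_all_finite)
  fix i
  show "eventually (\<lambda>t. (G *v z t) $ i \<le> W $ i + (S *v y t) $ i) F"
  proof (cases "i \<in> act x")
    case False
    have "((\<lambda>t. (G *v z t) $ i) \<longlongrightarrow> (G *v zmin x) $ i) F"
      using z by (simp add: matrix_vector_mul_component) (intro tendsto_intros)
    moreover have "((\<lambda>t. W $ i + (S *v y t) $ i) \<longlongrightarrow> W $ i + (S *v x) $ i) F"
      using y by (simp add: matrix_vector_mul_component) (intro tendsto_intros)
    moreover have "(G *v zmin x) $ i < W $ i + (S *v x) $ i"
      using False zmin_feas[OF x] by (auto simp: mem_act feas_iff less_le)
    ultimately have "eventually (\<lambda>t. 0 < W $ i + (S *v y t) $ i - (G *v z t) $ i) F"
      by (intro order_tendstoD(1)[OF tendsto_diff]) auto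
    then show ?thesis by (rule eventually_mono) simp
  qed (rule act)
qed

text \<open>Small positive steps along \<open>d\<close> stay feasible, so the difference quotient
  \<open>d \<bullet> (H *v zmin x) + t * obj d\<close> is nonnegative; then \<open>t\<close> tends
  to 0.\<close>

lemma first_order_optimality:
  assumes x: "x \<in> X" and d: "\<And>i. i \<in> act x \<Longrightarrow> (G *v d) $ i \<le> 0"
  shows "0 \<le> d \<bullet> (H *v zmin x)"
proof -
  have "eventually (\<lambda>t::real. feas x (zmin x + t *\<^sub>R d)) (at_right 0)"
  proof (rule eventually_feas[OF x])
    show "((\<lambda>t::real. zmin x + t *\<^sub>R d) \<longlongrightarrow> zmin x) (at_right 0)"
      by (auto intro!: tendsto_eq_intros)
    show "eventually (\<lambda>t::real. (G *v (zmin x + t *\<^sub>R d)) $ i \<le> W $ i + (S *v x) $ i) (at_right 0)"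
      if "i \<in> act x" for i
      using eventually_at_right_less[of 0]
    proof eventually_elim
      case (elim t)
      have "t * (G *v d) $ i \<le> 0" using elim d[OF that] by (simp add: mult_nonneg_nonpos)
      moreover have "(G *v (zmin x + t *\<^sub>R d)) $ i = (G *v zmin x) $ i + t * (G *v d) $ i"
        unfolding matrix_vector_right_distrib matrix_vector_mult_scaleR by simp
      ultimately show ?case using that by (simp only: mem_act)
    qed
  qed simp
  then have "eventually (\<lambda>t. 0 \<le> d \<bullet> (H *v zmin x) + t * obj d) (at_right 0)"
    using eventually_at_right_less[of 0]
  proof eventually_elim
    case (elim t)
    have "obj (zmin x) \<le> obj (zmin x + t *\<^sub>R d)"
      using V_le[OF x elim(1)] by (simp add: primal_value_def)
    then have "0 \<le> t * (d \<bullet> (H *v zmin x) + t * obj d)"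
      unfolding obj_add obj_scaleR by (simp add: power2_eq_square algebra_simps)
    then show ?case using elim by (simp add: zero_le_mult_iff)
  qed
  moreover have "((\<lambda>t. d \<bullet> (H *v zmin x) + t * obj d) \<longlongrightarrow> d \<bullet> (H *v zmin x)) (at_right 0)"
    by (auto intro!: tendsto_eq_intros)
  ultimately show ?thesis
    by (intro tendsto_lowerbound) auto
qed

lemma multiplier_and_upper_bound:
  assumes x: "x \<in> X" and "LICQ H G W S x"
  obtains l C where "l \<ge> 0" and "dual x l = V x"
    and "eventually (\<lambda>y. V y \<le> V x + (- (transpose S *v l)) \<bullet> (y - x) + C * (norm (y - x))\<^sup>2) (nhds x)"
proof -
  let ?z = "zmin x"
  obtain L :: "real^'m \<Rightarrow> real^'s" where L: "linear L"
    "\<And>i w. i \<in> act x \<Longrightarrow> (G *v L w) $ i = w $ i"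
    using exists_right_inverse_on_rows assms(2) unfolding LICQ_def by blast
  \<comment> \<open>Applying the stationarity equation to \<open>L (axis i 1)\<close> forces this
    value for active \<open>i\<close>; the value 0 elsewhere gives complementary slackness.\<close>
  define l where "l = (\<chi> i. if i \<in> act x then - (L (axis i 1) \<bullet> (H *v ?z)) else 0)"
  have l_nonneg: "l \<ge> 0"
  proof -
    \<comment> \<open>For active \<open>i\<close>, this direction relaxes constraint
      \<open>i\<close> and leaves the other active ones unchanged.\<close>
    have "0 \<le> L (- axis i 1) \<bullet> (H *v ?z)" for i
      by (rule first_order_optimality[OF x]) (simp add: L axis_def)
    then show ?thesis by (auto simp: less_eq_vec_def l_def linear_neg[OF L(1)])
  qed
  have kernel: "d \<bullet> (H *v ?z) = 0" if "\<And>i. i \<in> act x \<Longrightarrow> (G *v d) $ i = 0" for d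
    using first_order_optimality[OF x, of d] first_order_optimality[OF x, of "- d"] that
    by (simp add: linear_neg[OF matrix_vector_mul_linear])
  have stationary: "d \<bullet> (H *v ?z) = - (l \<bullet> (G *v d))" for d
  proof -
    \<comment> \<open>\<open>d - L ?w\<close> is annihilated by all active rows, so only
      \<open>L ?w\<close> contributes, and it expands along the axis vectors.\<close>
    let ?w = "\<chi> i. if i \<in> act x then (G *v d) $ i else 0"
    have "(d - L ?w) \<bullet> (H *v ?z) = 0"
      by (rule kernel) (simp add: matrix_vector_mult_diff_distrib L)
    moreover have "L ?w = (\<Sum>i\<in>UNIV. ?w $ i *\<^sub>R L (axis i 1))"
      by (subst basis_expansion[symmetric])
        (simp only: linear_sum[OF L(1)] linear_cmul[OF L(1)] scalar_mult_eq_scaleR)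
    then have "L ?w \<bullet> (H *v ?z) = (\<Sum>i\<in>UNIV. ?w $ i * (L (axis i 1) \<bullet> (H *v ?z)))"
      by (simp only: inner_sum_left inner_scaleR_left)
    moreover have "\<dots> = - (l \<bullet> (G *v d))"
      unfolding inner_vec_def[of l] sum_negf[symmetric] by (intro sum.cong refl) (simp add: l_def)
    ultimately show ?thesis by (simp add: inner_diff_left)
  qed
  have complementary: "l \<bullet> (G *v ?z) = l \<bullet> (W + S *v x)"
    unfolding inner_vec_def by (intro sum.cong refl) (simp add: l_def mem_act)
  have "transpose G *v l = H *v (- ?z)"
  proof (rule vector_eq_rdot[THEN iffD1], rule allI)
    fix d
    show "(transpose G *v l) \<bullet> d = (H *v (- ?z)) \<bullet> d"
      using stationary[of d]
      by (simp only: transpose_inner linear_neg[OF matrix_vector_mul_linear]) (simp add: inner_commute)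
  qed
  then have "l \<bullet> ((G ** matrix_inv H ** transpose G) *v l) = ?z \<bullet> (H *v ?z)"
    unfolding dual_quadratic
    by (simp only: matrix_inv_H linear_neg[OF matrix_vector_mul_linear] inner_minus_left inner_minus_right
        minus_minus inner_commute)
  \<comment> \<open>The quadratic term contributes \<open>- obj ?z\<close>, and complementarity with
    stationarity turns the linear term into \<open>2 * obj ?z\<close>.\<close>
  then have strong: "dual x l = V x"
    unfolding dual_objective_def primal_value_def primal_objective_def
    using stationary[of ?z] complementary by linarith
  define M where "M h = L (S *v h)" for h
  have M: "linear M"
    unfolding M_def using linear_compose[OF matrix_vector_mul_linear L(1)] by (simp add: o_def)
  obtain C where C: "\<And>h. M h \<bullet> (H *v M h) \<le> C * (norm h)\<^sup>2"
    using quadratic_form_linear_bound[OF M] by blast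
  have active_preserved: "(G *v (?z + M h)) $ i = W $ i + (S *v (x + h)) $ i" if "i \<in> act x" for h i
    using that by (simp add: M_def matrix_vector_right_distrib L mem_act)
  have "eventually (\<lambda>y. feas y (?z + M (y - x))) (nhds x)"
  proof (rule eventually_feas[OF x])
    have "((\<lambda>y. ?z + M (y - x)) \<longlongrightarrow> ?z + M (x - x)) (nhds x)"
      by (intro tendsto_add tendsto_const tendsto_diff filterlim_ident
          bounded_linear.tendsto[OF linear_conv_bounded_linear[THEN iffD1, OF M]])
    then show "((\<lambda>y. ?z + M (y - x)) \<longlongrightarrow> ?z) (nhds x)"
      by (simp add: linear_0[OF M])
    show "eventually (\<lambda>y. (G *v (?z + M (y - x))) $ i \<le> W $ i + (S *v y) $ i) (nhds x)"
      if "i \<in> act x" for i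
      using active_preserved[OF that, of "y - x" for y] by simp
  qed (rule filterlim_ident)
  \<comment> \<open>The constant is \<open>C/2\<close> because the objective carries the factor
    1/2.\<close>
  then have "eventually (\<lambda>y. V y \<le> V x + (- (transpose S *v l)) \<bullet> (y - x) + C/2 * (norm (y - x))\<^sup>2) (nhds x)"
  proof eventually_elim
    case (elim y)
    let ?h = "y - x"
    \<comment> \<open>The two vectors agree on active rows only, but \<open>l\<close> vanishes on
      the others.\<close>
    have "l \<bullet> (G *v M ?h) = l \<bullet> (S *v ?h)"
      unfolding inner_vec_def by (intro sum.cong refl) (simp add: l_def M_def L)
    then have "M ?h \<bullet> (H *v ?z) = (- (transpose S *v l)) \<bullet> ?h"
      using stationary[of "M ?h"] by (simp only: inner_minus_left transpose_inner)
    moreover have "V y \<le> obj ?z + M ?h \<bullet> (H *v ?z) + obj (M ?h)"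
      using V_le[OF feas_imp_X[OF elim] elim] by (simp only: obj_add)
    ultimately show ?case
      using C[of ?h] by (simp add: primal_value_def primal_objective_def[of _ "M ?h"])
  qed
  with l_nonneg strong show ?thesis by (rule that)
qed

end

text \<open>Existence of a dual optimizer is asserted alongside the gradient formula so that
  quantifying over all optimizers is not vacuous.\<close>

theorem corollary3:
  fixes H :: "real^'s^'s" and G :: "real^'s^'m" and W :: "real^'m" and S :: "real^'n^'m"
  assumes "symmetric_matrix H" and "positive_definite H"
    and "full_dimensional (feasible_parameters G W S)"
    and "\<And>x. x \<in> feasible_parameters G W S \<Longrightarrow> LICQ H G W S x"
  shows "continuously_differentiable_on (primal_value H G W S)
           (interior (feasible_parameters G W S)) \<and>
         (\<forall>x \<in> interior (feasible_parameters G W S).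
            (\<exists>l. dual_optimizer H G W S x l) \<and>
            (\<forall>l. dual_optimizer H G W S x l \<longrightarrow>
               (GDERIV (primal_value H G W S) x :> - (transpose S *v l))))"
proof -
  interpret mpqp H G W S using assms by unfold_locales
  let ?U = "interior X"
  have opt: "\<exists>l. dual_optimizer H G W S x l"
    and grad: "\<And>l. dual_optimizer H G W S x l \<Longrightarrow> GDERIV V x :> - (transpose S *v l)"
    and sub: "\<And>l y. dual_optimizer H G W S x l \<Longrightarrow> y \<in> ?U \<Longrightarrow> V x + (- (transpose S *v l)) \<bullet> (y - x) \<le> V y"
    if "x \<in> ?U" for x
  proof -
    from that have x: "x \<in> X" using interior_subset by blast
    have near: "eventually (\<lambda>y. y \<in> X) (nhds x)"
      using that by (simp add: eventually_nhds_in_nhd)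
    obtain k C where k: "k \<ge> 0" "dual x k = V x"
      and upper: "eventually (\<lambda>y. V y \<le> V x + (- (transpose S *v k)) \<bullet> (y - x) + C * (norm (y - x))\<^sup>2) (nhds x)"
      using multiplier_and_upper_bound[OF x assms(4)[OF x]] by blast
    note iff = dual_optimizer_iff[OF x k]
    show "\<exists>l. dual_optimizer H G W S x l" using iff k by blast
    have lower: "eventually (\<lambda>y. V x + (- (transpose S *v l)) \<bullet> (y - x) \<le> V y) (nhds x)"
      if "dual_optimizer H G W S x l" for l
      using near by (rule eventually_mono) (use iff that subgradient in blast)
    \<comment> \<open>The upper bound is available only for the constructed multiplier
      \<open>k\<close>; other optimizers follow by uniqueness of subgradients.\<close>
    have deriv: "GDERIV V x :> - (transpose S *v k)"
      using lower upper iff k by (blast intro: GDERIV_sandwich)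
    show "GDERIV V x :> - (transpose S *v l)" if "dual_optimizer H G W S x l" for l
      using GDERIV_subgradient_unique[OF deriv lower[OF that]] deriv by simp
    show "V x + (- (transpose S *v l)) \<bullet> (y - x) \<le> V y"
      if "dual_optimizer H G W S x l" "y \<in> ?U" for l y
      using that iff subgradient interior_subset by blast
  qed
  \<comment> \<open>Any selection of optimizers will do, since each yields the same
    gradient.\<close>
  obtain lam where lam: "\<And>x. x \<in> ?U \<Longrightarrow> dual_optimizer H G W S x (lam x)"
    using opt by metis
  have "continuous_on ?U (\<lambda>x. - (transpose S *v lam x))"
    by (rule continuous_on_subgradient[of _ V]) (use lam grad sub in auto)
  then have "continuously_differentiable_on V ?U"
    unfolding continuously_differentiable_on_def
    by (intro exI[of _ "\<lambda>x. - (transpose S *v lam x)"] conjI ballI grad lam)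
  then show ?thesis by (intro conjI ballI allI impI opt grad)
qed

end
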